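(* Let $\mathcal{A}$ be a finite alphabet, let $\Omega, X\subseteq\mathcal{A}^{\mathbb{N}}$ be subshifts and let $p\geq 2$ be an integer. The entropy of the axial product of $X_\Omega^p$ and $X$ on $\mathbb{N}^2$ is $$h\left(X_{\Omega}^p\otimes X\right)=\frac{(p-1)^2}{p^2}\sum_{i=1}^\infty\frac{\lambda_i}{p^{i-1}},$$ where $$\lambda_i=\lim_{j\to\infty}\frac{\log\left|\mathcal{P}\left([1,i]\times[1,j],\,\Omega\otimes X\right)\right|}{j}.$$
   Context: $\mathbb{N}=\{1,2,\dots\}$ and $[1,n]=\{1,\dots,n\}$. A subshift is a closed shift-invariant subset of $\mathcal{A}^{\mathbb{N}}$. The multiplicative subshift is $X_\Omega^p=\{x\in\mathcal{A}^{\mathbb{N}}:(x_{ip^l})_{l=0}^\infty\in\Omega\text{ for all }i\in\mathbb{N}\text{ with }p\nmid i\}$. For $Y_1,Y_2\subseteq\mathcal{A}^{\mathbb{N}}$, the axial product $Y_1\otimes Y_2\subseteq\mathcal{A}^{\mathbb{N}^2}$ is the set of $x\in\mathcal{A}^{\mathbb{N}^2}$ such that $(x_{(j,b)})_{j\ge1}\in Y_1$ for every $b\in\mathbb{N}$ and $(x_{(a,j)})_{j\ge1}\in Y_2$ for every $a\in\mathbb{N}$. For a finite $\Lambda\subseteq\mathbb{N}^2$ and $Z\subseteq\mathcal{A}^{\mathbb{N}^2}$, $\mathcal{P}(\Lambda,Z)=\{(x_g)_{g\in\Lambda}\in\mathcal{A}^\Lambda:x\in Z\}$. The entropy of $Z$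 is $h(Z)=\lim_{n\to\infty}\frac{\log|\mathcal{P}([1,n]^2,Z)|}{n^2}$. *)

theory Defs
  imports "HOL-Analysis.Analysis"
begin

(* \<nat> = {1,2,...}.  A configuration over the alphabet A on an index set G is an element of
   G \<rightarrow>\<^sub>E A, i.e. a function with values in A on G that is undefined outside G, so that
   equality of configurations is equality on G. *)

definition seq_topology :: "'a set \<Rightarrow> (nat \<Rightarrow> 'a) topology" where
  "seq_topology A = product_topology (\<lambda>_. discrete_topology A) {1..}"

definition shift :: "(nat \<Rightarrow> 'a) \<Rightarrow> nat \<Rightarrow> 'a" where
  "shift x = (\<lambda>n\<in>{1..}. x (n + 1))"

(* Shift-invariance is forward invariance; closedin includes X \<subseteq> {1..} \<rightarrow>\<^sub>E A. *)
definition subshift :: "'a set \<Rightarrow> (nat \<Rightarrow> 'a) set \<Rightarrow> bool" where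
  "subshift A X \<longleftrightarrow> closedin (seq_topology A) X \<and> shift ` X \<subseteq> X"

(* The sequence (x (i * p ^ l)) for l = 0, 1, ... is re-indexed by n = l + 1. *)
definition mult_subshift :: "'a set \<Rightarrow> nat \<Rightarrow> (nat \<Rightarrow> 'a) set \<Rightarrow> (nat \<Rightarrow> 'a) set" where
  "mult_subshift A p \<Omega> =
    {x \<in> {1..} \<rightarrow>\<^sub>E A. \<forall>i\<ge>1. \<not> p dvd i \<longrightarrow> (\<lambda>n\<in>{1..}. x (i * p ^ (n - 1))) \<in> \<Omega>}"

definition axial_product ::
  "'a set \<Rightarrow> (nat \<Rightarrow> 'a) set \<Rightarrow> (nat \<Rightarrow> 'a) set \<Rightarrow> (nat \<times> nat \<Rightarrow> 'a) set" where
  "axial_product A Y\<^sub>1 Y\<^sub>2 =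
    {x \<in> ({1..} \<times> {1..}) \<rightarrow>\<^sub>E A.
      (\<forall>b\<ge>1. (\<lambda>j\<in>{1..}. x (j, b)) \<in> Y\<^sub>1) \<and> (\<forall>a\<ge>1. (\<lambda>j\<in>{1..}. x (a, j)) \<in> Y\<^sub>2)}"

definition patterns ::
  "(nat \<times> nat) set \<Rightarrow> (nat \<times> nat \<Rightarrow> 'a) set \<Rightarrow> (nat \<times> nat \<Rightarrow> 'a) set" where
  "patterns \<Lambda> Z = (\<lambda>x. restrict x \<Lambda>) ` Z"

(* Logarithm of the cardinality of a finite set, with log 0 = -\<infinity>
   (real ln would give ln 0 = 0).  The value -\<infinity> is relevant only for empty Z, which can
   occur even as an axial product of two nonempty subshifts. *)
definition log_card :: "'b set \<Rightarrow> ereal" where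
  "log_card S = (if S = {} then -\<infinity> else ereal (ln (real (card S))))"

definition entropy_seq :: "(nat \<times> nat \<Rightarrow> 'a) set \<Rightarrow> nat \<Rightarrow> ereal" where
  "entropy_seq Z n = log_card (patterns ({1..n} \<times> {1..n}) Z) / ereal (real (n ^ 2))"

definition entropy :: "(nat \<times> nat \<Rightarrow> 'a) set \<Rightarrow> ereal" where
  "entropy Z = lim (entropy_seq Z)"

definition strip_seq :: "(nat \<times> nat \<Rightarrow> 'a) set \<Rightarrow> nat \<Rightarrow> nat \<Rightarrow> ereal" where
  "strip_seq Z i j = log_card (patterns ({1..i} \<times> {1..j}) Z) / ereal (real j)"

definition strip_entropy :: "(nat \<times> nat \<Rightarrow> 'a) set \<Rightarrow> nat \<Rightarrow> ereal" where
  "strip_entropy Z i = lim (strip_seq Z i)"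

end

theory Submission
  imports Defs
begin

text \<open>
  Every positive integer is uniquely \<open>i p\<^sup>l\<close> with \<open>p\<close> not dividing \<open>i\<close>, so a point of the axial product
  of the multiplicative subshift with \<open>X\<close> is an arbitrary family, indexed by such \<open>i\<close>, of points of
  the axial product of \<open>\<Omega>\<close> with \<open>X\<close>.  Hence the number of patterns on the square of side \<open>n\<close>
  is the product over \<open>i \<le> n\<close> of the number of patterns on a strip of height \<open>n\<close> whose width is
  the number of \<open>l\<close> with \<open>i p\<^sup>l \<le> n\<close>.  The number of \<open>i\<close> giving width \<open>k + 1\<close>, divided by \<open>n\<close>, tends to
  \<open>(p - 1)\<^sup>2 / p\<^bsup>k+2\<^esup>\<close>; the logarithmic strip counts divided by \<open>n\<close> converge by subadditivity under
  vertical shifts, and dominated convergence allows summing over \<open>k\<close>.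
\<close>

section \<open>Limits of sequences and series\<close>

text \<open>Fekete's lemma: the quotients tend to their infimum. Take \<open>m\<close> whose
  quotient is nearly the infimum and divide \<open>n\<close> by \<open>m\<close> with remainder; the
  remainder contributes only a bounded amount.\<close>

lemma fekete:
  fixes f :: "nat \<Rightarrow> real"
  assumes sub: "\<And>m n. f (m + n) \<le> f m + f n" and nonneg: "\<And>n. 0 \<le> f n"
  shows "convergent (\<lambda>n. f n / real n)"
proof -
  define L where "L = (INF n\<in>{1..}. f n / real n)"
  have bdd: "bdd_below ((\<lambda>n. f n / real n) ` {1..})"
    by (rule bdd_belowI[of _ 0]) (auto simp: nonneg)
  have lower: "L \<le> f n / real n" if "n \<ge> 1" for n
    unfolding L_def using that by (intro cINF_lower bdd) auto
  have mult: "f (q * m + r) \<le> real q * f m + f r" for q m r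
  proof (induction q)
    case (Suc q)
    have "f (Suc q * m + r) = f (m + (q * m + r))" by (simp add: add.assoc)
    also have "\<dots> \<le> f m + f (q * m + r)" by (rule sub)
    finally show ?case using Suc by (simp add: algebra_simps)
  qed simp
  have "(\<lambda>n. f n / real n) \<longlonglongrightarrow> L"
  proof (rule tendstoI)
    fix e :: real assume e: "e > 0"
    have "\<exists>m\<in>{1..}. f m / real m < L + e / 2"
      using e cINF_less_iff[OF _ bdd, of "L + e / 2"] unfolding L_def by auto
    then obtain m where m: "m \<ge> 1" "f m / real m < L + e / 2" by auto
    \<comment> \<open>\<open>C\<close> bounds \<open>f\<close> on all remainders modulo
      \<open>m\<close>, so their share \<open>C / real n\<close> vanishes in the limit.\<close>
    define C where "C = Max (f ` {..<m})"
    have C: "f r \<le> C" if "r < m" for r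
      unfolding C_def using that by (intro Max_ge) auto
    have upper: "f n / real n \<le> f m / real m + C / real n" if n: "n \<ge> 1" for n
    proof -
      have "f n \<le> real (n div m) * f m + f (n mod m)"
        using mult[of "n div m" m "n mod m"] by simp
      also have "\<dots> \<le> (real n / real m) * f m + C"
        using m(1) C[of "n mod m"] nonneg[of m]
        by (intro add_mono mult_right_mono of_nat_div_le_of_nat) auto
      finally have "f n / real n \<le> ((real n / real m) * f m + C) / real n"
        by (rule divide_right_mono) simp
      also have "\<dots> = f m / real m + C / real n"
        using n m by (simp add: field_simps)
      finally show ?thesis .
    qed
    have "(\<lambda>n. C / real n) \<longlonglongrightarrow> 0"
      by (rule lim_const_over_n)
    then have "\<forall>\<^sub>F n in sequentially. C / real n < e / 2"
      by (rule order_tendstoD(2)) (use e in simp)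
    then show "\<forall>\<^sub>F n in sequentially. dist (f n / real n) L < e"
      using eventually_ge_at_top[of 1]
    proof eventually_elim
      case (elim n)
      then have "L \<le> f n / real n" "f n / real n < L + e"
        using lower[of n] upper[of n] m(2) by linarith+
      then show ?case by (simp add: dist_real_def)
    qed
  qed
  then show ?thesis by (rule convergentI)
qed

text \<open>Tannery's theorem, read off from dominated convergence for the counting measure on the
  natural numbers.\<close>

lemma tendsto_suminf_dominated:
  fixes f :: "nat \<Rightarrow> nat \<Rightarrow> real"
  assumes bound: "\<And>n k. norm (f n k) \<le> M k" and M: "summable M"
    and lim: "\<And>k. (\<lambda>n. f n k) \<longlonglongrightarrow> g k"
  shows "summable g" "(\<lambda>n. \<Sum>k. f n k) \<longlonglongrightarrow> (\<Sum>k. g k)"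
proof -
  have M0: "0 \<le> M k" for k using bound[of 0 k] by (meson norm_ge_zero order_trans)
  have M': "integrable (count_space UNIV) M"
    using M M0 by (simp add: integrable_count_space_nat_iff)
  have dom: "integrable (count_space UNIV) g"
    "\<And>n. integrable (count_space UNIV) (f n)"
    "(\<lambda>n. integral\<^sup>L (count_space UNIV) (f n)) \<longlonglongrightarrow> integral\<^sup>L (count_space UNIV) g"
    by (rule integrable_dominated_convergence[OF _ _ M', of g f]
          integrable_dominated_convergence2[OF _ _ M', of g f]
          integral_dominated_convergence[OF _ _ M', of g f];
        simp add: lim bound del: real_norm_def)+
  show "summable g"
    using dom(1) summable_norm_cancel unfolding integrable_count_space_nat_iff by blast
  show "(\<lambda>n. \<Sum>k. f n k) \<longlonglongrightarrow> (\<Sum>k. g k)"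
    using dom(3) by (simp add: integral_count_space_nat dom)
qed

lemma tendsto_div_over_nat:
  assumes "d \<ge> 1"
  shows "(\<lambda>n. real (n div d) / real n) \<longlonglongrightarrow> 1 / real d"
proof (rule tendsto_sandwich)
  show "(\<lambda>n. 1 / real d - 1 / real n) \<longlonglongrightarrow> 1 / real d"
    using tendsto_diff[OF tendsto_const lim_const_over_n[of "1::real"], of "1 / real d"] by simp
  show "(\<lambda>n. 1 / real d) \<longlonglongrightarrow> 1 / real d" by simp
  show "\<forall>\<^sub>F n in sequentially. 1 / real d - 1 / real n \<le> real (n div d) / real n"
    using eventually_ge_at_top[of 1]
  proof eventually_elim
    case (elim n)
    have "real n = real (n div d) * real d + real (n mod d)"
      by (metis div_mult_mod_eq of_nat_add of_nat_mult)
    moreover have "real (n mod d) \<le> real d" using assms by (simp add: less_imp_le)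
    ultimately have "real n / real d - 1 \<le> real (n div d)"
      using assms by (simp add: field_simps)
    then have "(real n / real d - 1) / real n \<le> real (n div d) / real n"
      by (rule divide_right_mono) simp
    then show ?case using elim assms by (simp add: field_simps)
  qed
  show "\<forall>\<^sub>F n in sequentially. real (n div d) / real n \<le> 1 / real d"
    using eventually_ge_at_top[of 1]
  proof eventually_elim
    case (elim n)
    have "real (n div d) / real n \<le> (real n / real d) / real n"
      by (intro divide_right_mono of_nat_div_le_of_nat) simp
    then show ?case using elim assms by simp
  qed
qed

section \<open>Axial products and strips\<close>

lemma subshift_PiE:
  assumes "subshift A X" "x \<in> X"
  shows "x \<in> {1..} \<rightarrow>\<^sub>E A"
  using assms closedin_subset unfolding subshift_def seq_topology_def by fastforce

lemma subshift_shift_power: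
  assumes X: "subshift A X" and x: "x \<in> X"
  shows "(\<lambda>n\<in>{1..}. x (n + m)) \<in> X"
proof (induction m)
  case 0
  have "(\<lambda>n\<in>{1..}. x (n + 0)) = x" using subshift_PiE[OF X x] by (simp add: PiE_restrict)
  then show ?case using x by metis
next
  case (Suc m)
  have "(\<lambda>n\<in>{1..}. x (n + Suc m)) = shift (\<lambda>n\<in>{1..}. x (n + m))"
    by (auto simp: shift_def restrict_def)
  then show ?case using X Suc unfolding subshift_def by (metis image_subset_iff)
qed

text \<open>The shift merely renumbers the rows, whereas each column is replaced by a shift of
  itself and stays in \<open>X\<close> by shift-invariance.\<close>

lemma axial_product_vertical_shift:
  assumes X: "subshift A X" and x: "x \<in> axial_product A Y X"
  shows "(\<lambda>(a, b)\<in>{1..} \<times> {1..}. x (a, b + m)) \<in> axial_product A Y X"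
    (is "?y \<in> _")
proof -
  have row: "(\<lambda>j\<in>{1..}. ?y (j, b)) = (\<lambda>j\<in>{1..}. x (j, b + m))" if "b \<ge> 1" for b
    using that by auto
  have col: "(\<lambda>j\<in>{1..}. ?y (a, j)) = (\<lambda>n\<in>{1..}. (\<lambda>j\<in>{1..}. x (a, j)) (n + m))" if "a \<ge> 1" for a
    using that by auto
  show ?thesis
    unfolding axial_product_def
  proof (intro CollectI conjI allI impI)
    show "?y \<in> ({1..} \<times> {1..}) \<rightarrow>\<^sub>E A"
      using x by (auto simp: axial_product_def PiE_iff)
    fix c :: nat assume c: "c \<ge> 1"
    show "(\<lambda>j\<in>{1..}. ?y (j, c)) \<in> Y"
      unfolding row[OF c] using x c by (auto simp: axial_product_def)
    have "(\<lambda>j\<in>{1..}. x (c, j)) \<in> X"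
      using x c unfolding axial_product_def by blast
    then show "(\<lambda>j\<in>{1..}. ?y (c, j)) \<in> X"
      unfolding col[OF c] by (rule subshift_shift_power[OF X])
  qed
qed

lemma patterns_axial_product_subset:
  "patterns ({1..i} \<times> {1..j}) (axial_product A Y X) \<subseteq> ({1..i} \<times> {1..j}) \<rightarrow>\<^sub>E A"
proof -
  have "restrict x ({1..i} \<times> {1..j}) \<in> ({1..i} \<times> {1..j}) \<rightarrow>\<^sub>E A"
    if x: "x \<in> axial_product A Y X" for x
  proof -
    have "x \<in> ({1..} \<times> {1..}) \<rightarrow>\<^sub>E A" using x by (simp add: axial_product_def)
    then have "\<forall>g\<in>{1..i} \<times> {1..j}. x g \<in> A" by (auto intro: PiE_mem)
    then show ?thesis unfolding restrict_PiE_iff by blast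
  qed
  then show ?thesis unfolding patterns_def by blast
qed

section \<open>Pattern counts on rectangles: size bound and subadditivity in the height\<close>

context
  fixes A :: "'a set" and Y X :: "(nat \<Rightarrow> 'a) set" and Z
  assumes A: "finite A"
  defines "Z \<equiv> axial_product A Y X"
begin

lemma finite_patterns: "finite (patterns ({1..i} \<times> {1..j}) Z)"
  unfolding Z_def
  by (rule finite_subset[OF patterns_axial_product_subset finite_PiE]) (use A in auto)

lemma card_patterns_le: "card (patterns ({1..i} \<times> {1..j}) Z) \<le> card A ^ (i * j)"
proof -
  have "card (patterns ({1..i} \<times> {1..j}) Z) \<le> card (({1..i} \<times> {1..j}) \<rightarrow>\<^sub>E A)"
    unfolding Z_def by (intro card_mono finite_PiE patterns_axial_product_subset) (use A in auto)
  then show ?thesis by (simp add: card_PiE)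
qed

lemma card_patterns_pos:
  assumes "Z \<noteq> {}"
  shows "card (patterns ({1..i} \<times> {1..j}) Z) \<ge> 1"
  using finite_patterns[of i j] assms by (simp add: Suc_le_eq card_gt_0_iff patterns_def)

text \<open>Cut the rectangle at height \<open>m\<close>. The lower and upper blocks determine the
  pattern, and the upper block, moved down by \<open>m\<close>, is again a pattern of
  \<open>Z\<close> by vertical shift-invariance.\<close>

lemma card_patterns_add_le:
  assumes X: "subshift A X"
  shows "card (patterns ({1..i} \<times> {1..m + n}) Z)
    \<le> card (patterns ({1..i} \<times> {1..m}) Z) * card (patterns ({1..i} \<times> {1..n}) Z)"
proof -
  let ?P = "\<lambda>j. patterns ({1..i} \<times> {1..j}) Z"
  define F :: "(nat \<times> nat \<Rightarrow> 'a) \<Rightarrow> _" where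
    "F u = (restrict u ({1..i} \<times> {1..m}), \<lambda>(a, b)\<in>{1..i} \<times> {1..n}. u (a, b + m))" for u
  have "card (?P (m + n)) \<le> card (?P m \<times> ?P n)"
  proof (rule card_inj_on_le)
    show "F ` ?P (m + n) \<subseteq> ?P m \<times> ?P n"
    proof
      fix v assume "v \<in> F ` ?P (m + n)"
      then obtain x where x: "x \<in> Z" and v: "v = F (restrict x ({1..i} \<times> {1..m + n}))"
        by (auto simp: patterns_def)
      have "v = (restrict x ({1..i} \<times> {1..m}),
          restrict (\<lambda>(a, b)\<in>{1..} \<times> {1..}. x (a, b + m)) ({1..i} \<times> {1..n}))"
        unfolding v F_def by (intro conjI prod_eqI ext) (auto simp: restrict_apply)
      then show "v \<in> ?P m \<times> ?P n"
        using x axial_product_vertical_shift[OF X x[unfolded Z_def], of m]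
        unfolding patterns_def Z_def by blast
    qed
    show "inj_on F (?P (m + n))"
    proof (rule inj_onI)
      fix u v assume u: "u \<in> ?P (m + n)" and v: "v \<in> ?P (m + n)" and eq: "F u = F v"
      have "u (a, b) = v (a, b)" if ab: "(a, b) \<in> {1..i} \<times> {1..m + n}" for a b
      proof (cases "b \<le> m")
        case True
        have "restrict u ({1..i} \<times> {1..m}) (a, b) = restrict v ({1..i} \<times> {1..m}) (a, b)"
          using eq unfolding F_def by simp
        then show ?thesis using True ab by simp
      next
        case False
        have "(\<lambda>(a, b)\<in>{1..i} \<times> {1..n}. u (a, b + m)) (a, b - m)
            = (\<lambda>(a, b)\<in>{1..i} \<times> {1..n}. v (a, b + m)) (a, b - m)"
          using eq unfolding F_def by simp
        moreover have "Suc 0 \<le> b - m" "b - m \<le> n" using False ab by auto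
        ultimately show ?thesis using False ab by simp
      qed
      then show "u = v"
        using u v patterns_axial_product_subset[of i "m + n" A Y X] unfolding Z_def
        by (intro PiE_ext[of u "{1..i} \<times> {1..m + n}" "\<lambda>_. A"]) blast+
    qed
  qed (intro finite_cartesian_product finite_patterns)
  then show ?thesis by (simp add: card_cartesian_product)
qed

text \<open>Being linear in both the width and the height, this bound later yields the summable
  majorant for dominated convergence.\<close>

lemma ln_card_patterns_le:
  assumes "Z \<noteq> {}"
  shows "ln (real (card (patterns ({1..i} \<times> {1..j}) Z))) \<le> real i * real j * ln (real (card A))"
proof (cases "i * j = 0")
  case True
  then show ?thesis using card_patterns_le[of i j] card_patterns_pos[OF assms, of i j] by auto
next
  case False
  \<comment> \<open>A nonempty \<open>Z\<close> has a pattern on a single cell, which needs a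
    letter.\<close>
  have "A \<noteq> {}"
  proof
    assume "A = {}"
    then show False using card_patterns_le[of 1 1] card_patterns_pos[OF assms, of 1 1] by simp
  qed
  then have pos: "card A > 0" using A by (simp add: card_gt_0_iff)
  have "real (card (patterns ({1..i} \<times> {1..j}) Z)) \<le> real (card A ^ (i * j))"
    using card_patterns_le of_nat_le_iff by blast
  then have "ln (real (card (patterns ({1..i} \<times> {1..j}) Z))) \<le> ln (real (card A) ^ (i * j))"
    using card_patterns_pos[OF assms, of i j] pos by (intro ln_mono) simp_all
  also have "\<dots> = real i * real j * ln (real (card A))"
    using pos by (simp add: ln_realpow)
  finally show ?thesis .
qed

text \<open>Logarithms turn submultiplicative counts into a subadditive sequence in
  \<open>j\<close>; it is nonnegative because a nonempty \<open>Z\<close> has at least one pattern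
  on every rectangle.\<close>

lemma strip_convergent:
  assumes "subshift A X" "Z \<noteq> {}"
  shows "convergent (\<lambda>j. ln (real (card (patterns ({1..i} \<times> {1..j}) Z))) / real j)"
proof (rule fekete)
  note pos = card_patterns_pos[OF assms(2)]
  fix m n
  show "0 \<le> ln (real (card (patterns ({1..i} \<times> {1..n}) Z)))"
    using pos[of i n] by simp
  have "real (card (patterns ({1..i} \<times> {1..m + n}) Z))
      \<le> real (card (patterns ({1..i} \<times> {1..m}) Z)) * real (card (patterns ({1..i} \<times> {1..n}) Z))"
    using card_patterns_add_le[OF assms(1), of i m n] by (metis of_nat_le_iff of_nat_mult)
  then have "ln (real (card (patterns ({1..i} \<times> {1..m + n}) Z)))
      \<le> ln (real (card (patterns ({1..i} \<times> {1..m}) Z)) * real (card (patterns ({1..i} \<times> {1..n}) Z)))"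
    using pos[of i "m + n"] by simp
  also have "\<dots> = ln (real (card (patterns ({1..i} \<times> {1..m}) Z)))
      + ln (real (card (patterns ({1..i} \<times> {1..n}) Z)))"
    using pos[of i m] pos[of i n] by (simp add: ln_mult)
  finally show "ln (real (card (patterns ({1..i} \<times> {1..m + n}) Z)))
      \<le> ln (real (card (patterns ({1..i} \<times> {1..m}) Z)))
      + ln (real (card (patterns ({1..i} \<times> {1..n}) Z)))" .
qed

end

section \<open>Decomposition along multiplicative chains\<close>

text \<open>The columns of \<open>x\<close> over \<open>i, i * p, i * p ^ 2, ...\<close> are
  renumbered from 1, hence the exponent \<open>a - 1\<close>, so that they form a configuration on
  the whole quadrant.\<close>

definition chain :: "nat \<Rightarrow> nat \<Rightarrow> (nat \<times> nat \<Rightarrow> 'a) \<Rightarrow> nat \<times> nat \<Rightarrow> 'a" where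
  "chain p i x = (\<lambda>(a, b)\<in>{1..} \<times> {1..}. x (i * p ^ (a - 1), b))"

text \<open>Here \<open>p\<close> may be composite: \<open>i\<close> is not divisible by
  \<open>p\<close> but can share factors with it.\<close>

lemma nat_eq_coprime_part_times_power:
  fixes p a :: nat
  assumes "p \<ge> 2" "a \<ge> 1"
  obtains i l where "i \<ge> 1" "\<not> p dvd i" "a = i * p ^ l"
proof -
  have "a \<noteq> 0" "\<not> is_unit p" using assms by auto
  then obtain y where "a = p ^ multiplicity p a * y" "\<not> p dvd y"
    by (rule multiplicity_decompose')
  then show thesis
    using that[of y "multiplicity p a"] assms by (cases "y = 0") (auto simp: mult.commute)
qed

text \<open>The rows of a chain are exactly the subsequences that \<open>mult_subshift\<close>
  tests, and the columns of a chain are columns of \<open>x\<close>. So the row and column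
  conditions on \<open>x\<close> split into separate conditions on its chains.\<close>

lemma mem_mult_axial_product_iff:
  assumes p: "p \<ge> 2"
  shows "x \<in> axial_product A (mult_subshift A p \<Omega>) X \<longleftrightarrow>
    x \<in> ({1..} \<times> {1..}) \<rightarrow>\<^sub>E A \<and>
    (\<forall>i\<ge>1. \<not> p dvd i \<longrightarrow> chain p i x \<in> axial_product A \<Omega> X)"
    (is "?L \<longleftrightarrow> ?R")
proof
  have pos: "i * p ^ l \<ge> 1" if "i \<ge> 1" for i l using that p by (simp add: Suc_le_eq)
  have row: "(\<lambda>j\<in>{1..}. chain p i x (j, b)) = (\<lambda>n\<in>{1..}. (\<lambda>j\<in>{1..}. x (j, b)) (i * p ^ (n - 1)))"
    if "b \<ge> 1" "i \<ge> 1" for b i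
    using that pos by (auto simp: chain_def restrict_def)
  have col: "(\<lambda>j\<in>{1..}. chain p i x (a, j)) = (\<lambda>j\<in>{1..}. x (i * p ^ (a - 1), j))" if "a \<ge> 1" for a i
    using that by (auto simp: chain_def restrict_def)
  {
    assume L: ?L
    show ?R
    proof (intro conjI allI impI)
      show x: "x \<in> ({1..} \<times> {1..}) \<rightarrow>\<^sub>E A" using L by (simp add: axial_product_def)
      fix i assume i: "i \<ge> 1" "\<not> p dvd i"
      show "chain p i x \<in> axial_product A \<Omega> X"
        unfolding axial_product_def
      proof (intro CollectI conjI allI impI)
        show "chain p i x \<in> ({1..} \<times> {1..}) \<rightarrow>\<^sub>E A"
          using x pos[OF i(1)] by (auto simp: chain_def PiE_iff)
        fix c :: nat assume c: "c \<ge> 1"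
        have "(\<lambda>j\<in>{1..}. x (j, c)) \<in> mult_subshift A p \<Omega>"
          using L c by (simp add: axial_product_def)
        then show "(\<lambda>j\<in>{1..}. chain p i x (j, c)) \<in> \<Omega>"
          unfolding row[OF c i(1)] using i unfolding mult_subshift_def by blast
        show "(\<lambda>j\<in>{1..}. chain p i x (c, j)) \<in> X"
          unfolding col[OF c] using L pos[OF i(1)] by (simp add: axial_product_def)
      qed
    qed
  next
    assume R: ?R
    show ?L
      unfolding axial_product_def
    proof (intro CollectI conjI allI impI)
      show x: "x \<in> ({1..} \<times> {1..}) \<rightarrow>\<^sub>E A" using R by simp
      fix c :: nat assume c: "c \<ge> 1"
      have "(\<lambda>n\<in>{1..}. (\<lambda>j\<in>{1..}. x (j, c)) (i * p ^ (n - 1))) \<in> \<Omega>" if "i \<ge> 1" "\<not> p dvd i" for i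
        unfolding row[OF c that(1), symmetric] using R that c by (simp add: axial_product_def)
      then show "(\<lambda>j\<in>{1..}. x (j, c)) \<in> mult_subshift A p \<Omega>"
        unfolding mult_subshift_def using x c by (auto simp: PiE_iff)
      \<comment> \<open>Every column of \<open>x\<close> lies on some chain, where it is column
        \<open>Suc l\<close>.\<close>
      obtain i l where il: "i \<ge> 1" "\<not> p dvd i" "c = i * p ^ l"
        using nat_eq_coprime_part_times_power[OF p c] .
      have "(\<lambda>j\<in>{1..}. chain p i x (Suc l, j)) \<in> X"
        using R il by (simp add: axial_product_def)
      then show "(\<lambda>j\<in>{1..}. x (c, j)) \<in> X"
        using col[of "Suc l" i] il by simp
    qed
  }
qed

text \<open>The chains partition the positive integers, so points prescribed on them independently
  can be assembled into one configuration.\<close>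

lemma ex_glue_chains:
  assumes p: "p \<ge> 2" and z: "\<And>i. z i \<in> axial_product A \<Omega> X"
  obtains x where "x \<in> axial_product A (mult_subshift A p \<Omega>) X"
    "\<And>i. i \<ge> 1 \<Longrightarrow> \<not> p dvd i \<Longrightarrow> chain p i x = z i"
proof -
  \<comment> \<open>The column \<open>a\<close> belongs to the chain starting at \<open>a\<close>
    divided by its largest power of \<open>p\<close>; the exponent of that power, plus one, is its
    position there.\<close>
  define x where "x = (\<lambda>(a, b)\<in>{1..} \<times> {1..}.
    z (a div p ^ multiplicity p a) (Suc (multiplicity p a), b))"
  have z_PiE: "z i \<in> ({1..} \<times> {1..}) \<rightarrow>\<^sub>E A" for i using z[of i] by (simp add: axial_product_def)
  have chain: "chain p i x = z i" if i: "i \<ge> 1" "\<not> p dvd i" for i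
  proof (rule PiE_ext)
    have mult: "multiplicity p (i * p ^ l) = l" for l
      using i p by (intro multiplicity_decomposeI[of _ _ _ i]) (auto simp: mult.commute)
    have pos: "i * p ^ l \<ge> 1" for l using i p by (simp add: Suc_le_eq)
    have x_chain: "x (i * p ^ l, b) = z i (Suc l, b)" if "b \<ge> 1" for l b
      using that pos[of l] p by (simp add: x_def mult)
    show "chain p i x \<in> ({1..} \<times> {1..}) \<rightarrow>\<^sub>E A"
      using z_PiE[of i] by (auto simp: chain_def x_chain PiE_iff simp del: One_nat_def)
    show "z i \<in> ({1..} \<times> {1..}) \<rightarrow>\<^sub>E A" by (rule z_PiE)
    fix g :: "nat \<times> nat" assume "g \<in> {1..} \<times> {1..}"
    then show "chain p i x g = z i g"
      by (cases g) (auto simp: chain_def x_chain)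
  qed
  have "x \<in> ({1..} \<times> {1..}) \<rightarrow>\<^sub>E A"
    using z_PiE by (auto simp: x_def PiE_iff)
  then have "x \<in> axial_product A (mult_subshift A p \<Omega>) X"
    unfolding mem_mult_axial_product_iff[OF p] using chain z by simp
  then show thesis using chain that by blast
qed

text \<open>A single point can be glued with copies of itself on all chains; conversely, the chain
  starting at 1 extracts a point.\<close>

lemma mult_axial_product_eq_empty_iff:
  assumes p: "p \<ge> 2"
  shows "axial_product A (mult_subshift A p \<Omega>) X = {} \<longleftrightarrow> axial_product A \<Omega> X = {}"
proof
  assume "axial_product A (mult_subshift A p \<Omega>) X = {}"
  then show "axial_product A \<Omega> X = {}"
    using ex_glue_chains[OF p, of "\<lambda>_. z" A \<Omega> X for z] by blast
next
  have not_dvd_one: "\<not> p dvd 1" using p by simp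
  assume "axial_product A \<Omega> X = {}"
  then show "axial_product A (mult_subshift A p \<Omega>) X = {}"
    using mem_mult_axial_product_iff[OF p, of _ A \<Omega> X] not_dvd_one by blast
qed

text \<open>The number of elements of \<open>i, i p, i p\<^sup>2, \<dots>\<close> in the interval from 1 to \<open>n\<close>.\<close>

definition chain_length :: "nat \<Rightarrow> nat \<Rightarrow> nat \<Rightarrow> nat" where
  "chain_length p n i = (LEAST k. n < i * p ^ k)"

lemma less_chain_length_iff:
  assumes p: "p \<ge> 2" and i: "i \<ge> 1"
  shows "l < chain_length p n i \<longleftrightarrow> i * p ^ l \<le> n"
proof
  show "l < chain_length p n i \<Longrightarrow> i * p ^ l \<le> n"
    using not_less_Least unfolding chain_length_def by (meson linorder_not_less)
  show "l < chain_length p n i" if "i * p ^ l \<le> n"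
  proof (rule ccontr)
    assume "\<not> l < chain_length p n i"
    then have le: "i * p ^ chain_length p n i \<le> i * p ^ l"
      using p by (intro mult_le_mono2 power_increasing) auto
    \<comment> \<open>The exponent \<open>n\<close> satisfies the condition under
      \<open>LEAST\<close>, so the minimum is attained.\<close>
    have "n < p ^ n" using p by (intro power_gt_expt) auto
    also have "\<dots> \<le> i * p ^ n" using i by simp
    finally have "n < i * p ^ chain_length p n i"
      unfolding chain_length_def by (rule LeastI)
    then show False using le that by simp
  qed
qed

text \<open>Cutting a square pattern along the chains that start in the square is a bijection onto a
  product: it is injective because these chains cover the square, and surjective because chains can
  be glued freely.\<close>

lemma card_patterns_mult_axial_product:
  fixes A :: "'a set"
  assumes p: "p \<ge> 2" and ne: "axial_product A \<Omega> X \<noteq> {}"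
  shows "card (patterns ({1..n} \<times> {1..n}) (axial_product A (mult_subshift A p \<Omega>) X)) =
    (\<Prod>i\<in>{i\<in>{1..n}. \<not> p dvd i}.
      card (patterns ({1..chain_length p n i} \<times> {1..n}) (axial_product A \<Omega> X)))"
proof -
  define Y where "Y = axial_product A (mult_subshift A p \<Omega>) X"
  define Z where "Z = axial_product A \<Omega> X"
  define I where "I = {i\<in>{1..n}. \<not> p dvd i}"
  define R where "R i = {1..chain_length p n i} \<times> {1..n}" for i
  define F :: "(nat \<times> nat \<Rightarrow> 'a) \<Rightarrow> _" where
    "F u = (\<lambda>i\<in>I. \<lambda>(a, b)\<in>R i. u (i * p ^ (a - 1), b))" for u
  have len: "i * p ^ (a - 1) \<le> n \<longleftrightarrow> a \<le> chain_length p n i" if "i \<ge> 1" "a \<ge> 1" for i a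
    using less_chain_length_iff[OF p that(1), of "a - 1" n] that(2) by auto
  \<comment> \<open>The first \<open>chain_length p n i\<close> columns of the chain are exactly
    those inside the square, so cutting commutes with restricting.\<close>
  have F_restrict: "F (restrict x ({1..n} \<times> {1..n})) = (\<lambda>i\<in>I. restrict (chain p i x) (R i))" for x
  proof -
    have "i * p ^ (a - 1) \<in> {1..n}" if "i \<in> I" "a \<in> {1..chain_length p n i}" for i a
      using that p len[of i a] by (auto simp: I_def Suc_le_eq)
    then show ?thesis
      unfolding F_def R_def chain_def by (auto simp: fun_eq_iff restrict_def)
  qed
  have "bij_betw F (patterns ({1..n} \<times> {1..n}) Y) (PiE I (\<lambda>i. patterns (R i) Z))"
    unfolding bij_betw_def
  proof
    show "inj_on F (patterns ({1..n} \<times> {1..n}) Y)"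
    proof (rule inj_onI)
      fix u v assume u: "u \<in> patterns ({1..n} \<times> {1..n}) Y"
        and v: "v \<in> patterns ({1..n} \<times> {1..n}) Y" and eq: "F u = F v"
      have "u (a, b) = v (a, b)" if ab: "(a, b) \<in> {1..n} \<times> {1..n}" for a b
      proof -
        obtain i l where il: "i \<ge> 1" "\<not> p dvd i" "a = i * p ^ l"
          using nat_eq_coprime_part_times_power[OF p, of a] ab by auto
        have "i \<le> a" unfolding il(3) using p by simp
        moreover have "a \<le> n" using ab by simp
        ultimately have "i \<in> I" using il(1,2) by (simp add: I_def)
        moreover have "(Suc l, b) \<in> R i" using len[of i "Suc l"] il ab by (simp add: R_def)
        ultimately have "F w i (Suc l, b) = w (a, b)" for w using il by (simp add: F_def)
        then show ?thesis using eq by metis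
      qed
      then show "u = v"
        using u v patterns_axial_product_subset[of n n A "mult_subshift A p \<Omega>" X] unfolding Y_def
        by (intro PiE_ext[of u "{1..n} \<times> {1..n}" "\<lambda>_. A"]) blast+
    qed
    show "F ` patterns ({1..n} \<times> {1..n}) Y = PiE I (\<lambda>i. patterns (R i) Z)"
    proof
      show "F ` patterns ({1..n} \<times> {1..n}) Y \<subseteq> PiE I (\<lambda>i. patterns (R i) Z)"
      proof
        fix v assume "v \<in> F ` patterns ({1..n} \<times> {1..n}) Y"
        then obtain x where x: "x \<in> Y" and v: "v = F (restrict x ({1..n} \<times> {1..n}))"
          unfolding patterns_def by blast
        have "chain p i x \<in> Z" if "i \<in> I" for i
          using x that unfolding Y_def Z_def mem_mult_axial_product_iff[OF p] I_def by simp
        then show "v \<in> PiE I (\<lambda>i. patterns (R i) Z)"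
          unfolding v F_restrict patterns_def by (intro PiE_I) simp_all
      qed
      show "PiE I (\<lambda>i. patterns (R i) Z) \<subseteq> F ` patterns ({1..n} \<times> {1..n}) Y"
      proof
        fix w assume w: "w \<in> PiE I (\<lambda>i. patterns (R i) Z)"
        have "\<forall>i\<in>I. \<exists>z. z \<in> Z \<and> w i = restrict z (R i)"
          using w unfolding patterns_def by (blast dest: PiE_mem)
        then obtain z where z: "\<And>i. i \<in> I \<Longrightarrow> z i \<in> Z \<and> w i = restrict (z i) (R i)"
          by metis
        \<comment> \<open>Chains that start outside the square do not meet it; they are filled with
          an arbitrary point.\<close>
        obtain z0 where z0: "z0 \<in> Z" using ne unfolding Z_def by blast
        have "(if i \<in> I then z i else z0) \<in> axial_product A \<Omega> X" for i
          using z z0 unfolding Z_def by simp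
        then obtain x where x: "x \<in> Y"
          "\<And>i. i \<ge> 1 \<Longrightarrow> \<not> p dvd i \<Longrightarrow> chain p i x = (if i \<in> I then z i else z0)"
          using ex_glue_chains[OF p, of "\<lambda>i. if i \<in> I then z i else z0" A \<Omega> X]
          unfolding Y_def by blast
        have "w = F (restrict x ({1..n} \<times> {1..n}))"
          unfolding F_restrict
        proof
          fix i show "w i = (\<lambda>i\<in>I. restrict (chain p i x) (R i)) i"
          proof (cases "i \<in> I")
            case True
            then have "chain p i x = z i" using x(2)[of i] by (simp add: I_def)
            then show ?thesis using True z[of i] by simp
          next
            case False
            then show ?thesis using PiE_arb[OF w False] by simp
          qed
        qed
        then show "w \<in> F ` patterns ({1..n} \<times> {1..n}) Y"
          using x(1) unfolding patterns_def by blast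
      qed
    qed
  qed
  then have "card (patterns ({1..n} \<times> {1..n}) Y) = card (PiE I (\<lambda>i. patterns (R i) Z))"
    by (rule bij_betw_same_card)
  also have "\<dots> = (\<Prod>i\<in>I. card (patterns (R i) Z))"
    by (rule card_PiE) (simp add: I_def)
  finally show ?thesis unfolding Y_def Z_def I_def R_def .
qed

section \<open>Counting the chains of a given length\<close>

lemma card_not_dvd:
  fixes p :: nat
  assumes "p \<ge> 1"
  shows "card {i\<in>{1..m}. \<not> p dvd i} + m div p = m"
proof -
  have "{i\<in>{1..m}. p dvd i} = (\<lambda>j. p * j) ` {1..m div p}"
  proof (intro equalityI subsetI)
    fix i assume "i \<in> {i\<in>{1..m}. p dvd i}"
    then obtain j where "i = p * j" "1 \<le> i" "i \<le> m" by (auto elim: dvdE)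
    then show "i \<in> (\<lambda>j. p * j) ` {1..m div p}"
      using assms by (intro image_eqI[of _ _ j])
        (auto simp: less_eq_div_iff_mult_less_eq mult.commute Suc_le_eq)
  next
    fix i assume "i \<in> (\<lambda>j. p * j) ` {1..m div p}"
    then show "i \<in> {i\<in>{1..m}. p dvd i}"
      using assms by (auto simp: less_eq_div_iff_mult_less_eq mult.commute Suc_le_eq)
  qed
  moreover have "inj_on (\<lambda>j. p * j) {1..m div p}"
    using assms by (auto intro: inj_onI)
  ultimately have "card {i\<in>{1..m}. p dvd i} = m div p"
    by (simp add: card_image)
  moreover have "card {i\<in>{1..m}. \<not> p dvd i} + card {i\<in>{1..m}. p dvd i} = card {1..m}"
    by (subst card_Un_disjoint[symmetric])
      (auto intro!: arg_cong[where f = card] simp del: card_atLeastAtMost)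
  ultimately show ?thesis by simp
qed

text \<open>Length \<open>Suc k\<close> means that \<open>i\<close> lies above
  \<open>n div p ^ Suc k\<close> and at most at \<open>n div p ^ k\<close>. Counting non-multiples
  of \<open>p\<close> up to a bound gives a first difference, so the interval gives a second
  difference.\<close>

lemma card_chain_length_eq:
  assumes p: "p \<ge> 2"
  shows "real (card {i\<in>{1..n}. \<not> p dvd i \<and> chain_length p n i = Suc k}) =
    real (n div p ^ k) - 2 * real (n div p ^ Suc k) + real (n div p ^ Suc (Suc k))"
proof -
  define S where "S m = {i\<in>{1..m}. \<not> p dvd i}" for m
  have S: "real (card (S (n div p ^ j))) = real (n div p ^ j) - real (n div p ^ Suc j)" for j
  proof -
    have "card (S (n div p ^ j)) + n div p ^ j div p = n div p ^ j"
      unfolding S_def using p by (intro card_not_dvd) simp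
    moreover have "n div p ^ j div p = n div p ^ Suc j"
      by (simp add: div_mult2_eq[symmetric] mult.commute)
    ultimately show ?thesis by linarith
  qed
  have le_div: "i \<le> n div p ^ j \<longleftrightarrow> i * p ^ j \<le> n" for i j
    using p by (simp add: less_eq_div_iff_mult_less_eq)
  have eq: "{i\<in>{1..n}. \<not> p dvd i \<and> chain_length p n i = Suc k}
      = S (n div p ^ k) - S (n div p ^ Suc k)"
  proof (rule set_eqI)
    fix i
    have "i \<le> n" if "i * p ^ k \<le> n"
      using le_trans[OF _ that, of i] p by simp
    moreover have "chain_length p n i = Suc k \<longleftrightarrow> i * p ^ k \<le> n \<and> \<not> i * p ^ Suc k \<le> n" if "i \<ge> 1"
      unfolding less_chain_length_iff[OF p that, symmetric] by auto
    ultimately show "i \<in> {i\<in>{1..n}. \<not> p dvd i \<and> chain_length p n i = Suc k}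
        \<longleftrightarrow> i \<in> S (n div p ^ k) - S (n div p ^ Suc k)"
      unfolding S_def by (auto simp: le_div simp del: power_Suc)
  qed
  have "p ^ k \<le> p ^ Suc k" using p by (intro power_increasing) auto
  then have "n div p ^ Suc k \<le> n div p ^ k" using p by (intro div_le_mono2) auto
  then have sub: "S (n div p ^ Suc k) \<subseteq> S (n div p ^ k)" unfolding S_def by auto
  have fin: "finite (S m)" for m by (simp add: S_def)
  have "real (card (S (n div p ^ k) - S (n div p ^ Suc k)))
      = real (card (S (n div p ^ k))) - real (card (S (n div p ^ Suc k)))"
    using card_Diff_subset[OF fin sub] card_mono[OF fin sub] by simp
  then show ?thesis unfolding eq S by simp
qed

text \<open>The logarithm of the product over chains is grouped by chain length. The result is
  written as an infinite series, with zero terms from \<open>k = n\<close> on, to suit dominated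
  convergence.\<close>

lemma ln_card_patterns_mult_axial_product:
  assumes A: "finite A" and p: "p \<ge> 2" and ne: "axial_product A \<Omega> X \<noteq> {}"
  shows "ln (real (card (patterns ({1..n} \<times> {1..n}) (axial_product A (mult_subshift A p \<Omega>) X)))) =
    (\<Sum>k. real (card {i\<in>{1..n}. \<not> p dvd i \<and> chain_length p n i = Suc k}) *
      ln (real (card (patterns ({1..Suc k} \<times> {1..n}) (axial_product A \<Omega> X)))))"
proof -
  define c where "c k = card (patterns ({1..k} \<times> {1..n}) (axial_product A \<Omega> X))" for k
  define I where "I = {i\<in>{1..n}. \<not> p dvd i}"
  have pos: "c k > 0" for k
    using card_patterns_pos[OF A ne, of k n] by (simp add: c_def)
  have len: "1 \<le> chain_length p n i" "chain_length p n i \<le> n" if i: "i \<in> I" for i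
  proof -
    have i1: "i \<ge> 1" "i \<le> n" using i by (auto simp: I_def)
    show "1 \<le> chain_length p n i"
      using less_chain_length_iff[OF p i1(1), of 0 n] i1 by simp
    have "n < p ^ n" using p by (intro power_gt_expt) auto
    also have "\<dots> \<le> i * p ^ n" using i1 by simp
    finally show "chain_length p n i \<le> n"
      using less_chain_length_iff[OF p i1(1), of n n] by simp
  qed
  have I_eq: "{i\<in>I. chain_length p n i = Suc k}
      = {i\<in>{1..n}. \<not> p dvd i \<and> chain_length p n i = Suc k}" for k
    unfolding I_def by blast
  have fin: "finite I" by (simp add: I_def)
  have "ln (real (card (patterns ({1..n} \<times> {1..n}) (axial_product A (mult_subshift A p \<Omega>) X))))
      = (\<Sum>i\<in>I. ln (real (c (chain_length p n i))))"
    unfolding card_patterns_mult_axial_product[OF p ne] c_def[symmetric] I_def[symmetric]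
    using pos fin by (simp add: ln_prod)
  \<comment> \<open>Lengths lie between 1 and \<open>n\<close>, so grouping by length minus one
    loses nothing and needs only \<open>k < n\<close>.\<close>
  also have "\<dots> = (\<Sum>k<n. \<Sum>i\<in>{i\<in>I. chain_length p n i - 1 = k}. ln (real (c (chain_length p n i))))"
    using len by (intro sum.group[symmetric] fin) (fastforce simp: Suc_le_eq)+
  also have "\<dots> = (\<Sum>k<n. real (card {i\<in>I. chain_length p n i = Suc k}) * ln (real (c (Suc k))))"
  proof (rule sum.cong[OF refl])
    fix k
    have "{i\<in>I. chain_length p n i - 1 = k} = {i\<in>I. chain_length p n i = Suc k}"
      using len by force
    then show "(\<Sum>i\<in>{i\<in>I. chain_length p n i - 1 = k}. ln (real (c (chain_length p n i))))
        = real (card {i\<in>I. chain_length p n i = Suc k}) * ln (real (c (Suc k)))"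
      by simp
  qed
  also have "\<dots> = (\<Sum>k. real (card {i\<in>I. chain_length p n i = Suc k}) * ln (real (c (Suc k))))"
  proof (rule suminf_finite[symmetric])
    fix k assume "k \<notin> {..<n}"
    then have "{i\<in>I. chain_length p n i = Suc k} = {}" using len by fastforce
    then show "real (card {i\<in>I. chain_length p n i = Suc k}) * ln (real (c (Suc k))) = 0"
      by (simp only: card.empty of_nat_0 mult_zero_left)
  qed simp
  finally show ?thesis unfolding c_def I_eq .
qed

section \<open>The entropy formula\<close>

text \<open>Nonemptiness rules out the value -\<infinity> of \<open>log_card\<close>, so the
  extended real sequence follows the real one.\<close>

lemma strip_seq_tendsto:
  assumes A: "finite A" and X: "subshift A X" and ne: "axial_product A Y X \<noteq> {}"
  obtains L where
    "(\<lambda>j. ln (real (card (patterns ({1..i} \<times> {1..j}) (axial_product A Y X)))) / real j) \<longlonglongrightarrow> L"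
    "strip_seq (axial_product A Y X) i \<longlonglongrightarrow> ereal L"
proof -
  define f where
    "f j = ln (real (card (patterns ({1..i} \<times> {1..j}) (axial_product A Y X)))) / real j" for j
  obtain L where lim: "f \<longlonglongrightarrow> L"
    using strip_convergent[OF A X ne, of i] unfolding f_def convergent_def by blast
  have "\<forall>\<^sub>F j in sequentially. ereal (f j) = strip_seq (axial_product A Y X) i j"
    using eventually_ge_at_top[of 1]
    by eventually_elim (use ne in \<open>simp add: strip_seq_def log_card_def patterns_def f_def\<close>)
  then have "strip_seq (axial_product A Y X) i \<longlonglongrightarrow> ereal L"
    using lim by (subst tendsto_cong[symmetric]) auto
  then show thesis using that[OF lim[unfolded f_def]] by simp
qed

theorem theorem2p3:
  fixes A :: "'a set" and \<Omega> X :: "(nat \<Rightarrow> 'a) set" and p :: nat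
  assumes "finite A" and "subshift A \<Omega>" and "subshift A X" and "p \<ge> 2"
  shows "(\<forall>i\<ge>1. convergent (strip_seq (axial_product A \<Omega> X) i)) \<and>
    summable (\<lambda>k. strip_entropy (axial_product A \<Omega> X) (Suc k) / ereal (real p ^ k)) \<and>
    convergent (entropy_seq (axial_product A (mult_subshift A p \<Omega>) X)) \<and>
    entropy (axial_product A (mult_subshift A p \<Omega>) X) =
      ereal ((real p - 1)\<^sup>2 / (real p)\<^sup>2) *
      (\<Sum>k. strip_entropy (axial_product A \<Omega> X) (Suc k) / ereal (real p ^ k))"
proof (cases "axial_product A \<Omega> X = {}")
  \<comment> \<open>Both axial products are empty, and both sides of the formula equal
    -\<infinity>.\<close>
  case True
  note p = assms(4)
  have strip: "strip_seq (axial_product A \<Omega> X) i \<longlonglongrightarrow> -\<infinity>" for i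
  proof (rule tendsto_eventually)
    show "\<forall>\<^sub>F j in sequentially. strip_seq (axial_product A \<Omega> X) i j = -\<infinity>"
      using eventually_ge_at_top[of 1]
      by eventually_elim (simp add: strip_seq_def log_card_def patterns_def True)
  qed
  have ent: "entropy_seq (axial_product A (mult_subshift A p \<Omega>) X) \<longlonglongrightarrow> -\<infinity>"
  proof (rule tendsto_eventually)
    show "\<forall>\<^sub>F n in sequentially. entropy_seq (axial_product A (mult_subshift A p \<Omega>) X) n = -\<infinity>"
      using eventually_ge_at_top[of 1]
      by eventually_elim
        (simp add: entropy_seq_def log_card_def patterns_def
          mult_axial_product_eq_empty_iff[OF p] True)
  qed
  have summand: "strip_entropy (axial_product A \<Omega> X) (Suc k) / ereal (real p ^ k) = -\<infinity>" for k
    unfolding strip_entropy_def limI[OF strip] using p by (simp add: divide_ereal_def)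
  have "(\<lambda>k::nat. -\<infinity> :: ereal) sums -\<infinity>"
    unfolding sums_def
  proof (rule tendsto_eventually)
    \<comment> \<open>Only the empty partial sum differs from -\<infinity>.\<close>
    have "(\<Sum>k<Suc n. -\<infinity> :: ereal) = -\<infinity>" for n by (induction n) simp_all
    then have "(\<Sum>k<n. -\<infinity> :: ereal) = -\<infinity>" if "n \<ge> 1" for n :: nat
      using that by (cases n) auto
    then show "\<forall>\<^sub>F n in sequentially. (\<Sum>k<n. -\<infinity> :: ereal) = -\<infinity>"
      using eventually_sequentially by blast
  qed
  then have sums: "(\<lambda>k. strip_entropy (axial_product A \<Omega> X) (Suc k) / ereal (real p ^ k)) sums -\<infinity>"
    unfolding summand .
  have "(real p - 1)\<^sup>2 / (real p)\<^sup>2 > 0" using p by simp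
  then have "ereal ((real p - 1)\<^sup>2 / (real p)\<^sup>2) * -\<infinity> = -\<infinity>" using p by simp
  then have "entropy (axial_product A (mult_subshift A p \<Omega>) X) =
      ereal ((real p - 1)\<^sup>2 / (real p)\<^sup>2) *
      (\<Sum>k. strip_entropy (axial_product A \<Omega> X) (Suc k) / ereal (real p ^ k))"
    unfolding entropy_def limI[OF ent] sums_unique[OF sums, symmetric] by (rule sym)
  then show ?thesis
    by (intro conjI allI impI convergentI[OF strip] sums_summable[OF sums] convergentI[OF ent])
next
  case ne: False
  note A = assms(1) and X = assms(3) and p = assms(4)
  define Z where "Z = axial_product A \<Omega> X"
  define Y where "Y = axial_product A (mult_subshift A p \<Omega>) X"
  define c where "c k n = ln (real (card (patterns ({1..k} \<times> {1..n}) Z)))" for k n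
  define N where "N n k = real (card {i\<in>{1..n}. \<not> p dvd i \<and> chain_length p n i = Suc k})" for n k
  have "\<exists>L. (\<lambda>j. c i j / real j) \<longlonglongrightarrow> L \<and> strip_seq Z i \<longlonglongrightarrow> ereal L" for i
    using strip_seq_tendsto[OF A X ne, of i] unfolding c_def Z_def by blast
  then obtain lam where lam: "\<And>i. (\<lambda>j. c i j / real j) \<longlonglongrightarrow> lam i"
    "\<And>i. strip_seq Z i \<longlonglongrightarrow> ereal (lam i)"
    by metis
  have strip: "strip_entropy Z i = ereal (lam i)" for i
    unfolding strip_entropy_def by (rule limI[OF lam(2)])
  define r where "r = (real p - 1)\<^sup>2 / (real p)\<^sup>2"
  have r: "r > 0" using p by (simp add: r_def)
  define g where "g k = r / real p ^ k * lam (Suc k)" for k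
  \<comment> \<open>The majorant multiplies the bound \<open>(1 / real p) ^ k\<close> for the
    density of chains by the bound \<open>real (Suc k) * ln (real (card A))\<close> for the
    normalized strip count.\<close>
  define M where "M k = ln (real (card A)) * (real (Suc k) * (1 / real p) ^ k)" for k
  have c_nonneg: "0 \<le> c k n" for k n
    using card_patterns_pos[OF A ne, of k n] by (simp add: c_def Z_def)
  have N_le: "N n k \<le> real n / real p ^ k" for n k
  proof -
    have "p ^ Suc k \<le> p ^ Suc (Suc k)" using p by (intro power_increasing) auto
    then have "n div p ^ Suc (Suc k) \<le> n div p ^ Suc k" using p by (intro div_le_mono2) auto
    then have "real (n div p ^ Suc (Suc k)) \<le> 2 * real (n div p ^ Suc k)" by linarith
    then have "N n k \<le> real (n div p ^ k)"
      unfolding N_def card_chain_length_eq[OF p] by linarith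
    also have "\<dots> \<le> real n / real p ^ k"
      using of_nat_div_le_of_nat[of n "p ^ k"] by simp
    finally show ?thesis .
  qed
  have bound: "norm (N n k / real n * (c (Suc k) n / real n)) \<le> M k" for n k
  proof (cases "n = 0")
    case True
    \<comment> \<open>For \<open>n = 0\<close> the term is 0 by division by zero, so only
      nonnegativity of \<open>M k\<close> is at stake.\<close>
    have "0 \<le> ln (real (card A))" by (cases "card A = 0") auto
    then show ?thesis using True by (simp add: M_def)
  next
    case False
    have "c (Suc k) n / real n \<le> real (Suc k) * real n * ln (real (card A)) / real n"
      using ln_card_patterns_le[OF A ne, of "Suc k" n] unfolding c_def Z_def
      by (rule divide_right_mono) simp
    then have 1: "c (Suc k) n / real n \<le> real (Suc k) * ln (real (card A))"
      using False by simp
    have "N n k / real n \<le> real n / real p ^ k / real n"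
      by (rule divide_right_mono[OF N_le]) simp
    then have 2: "N n k / real n \<le> (1 / real p) ^ k"
      using False by (simp add: power_divide)
    have "N n k / real n * (c (Suc k) n / real n)
        \<le> (1 / real p) ^ k * (real (Suc k) * ln (real (card A)))"
      using c_nonneg[of "Suc k" n] by (intro mult_mono 1 2) auto
    moreover have "0 \<le> N n k / real n * (c (Suc k) n / real n)"
      using c_nonneg[of "Suc k" n] by (simp add: N_def)
    ultimately show ?thesis by (simp add: M_def mult_ac)
  qed
  \<comment> \<open>Up to a constant, this is the differentiated geometric series.\<close>
  have M: "summable M"
    unfolding M_def using geometric_deriv_sums[of "1 / real p"] p
    by (intro summable_mult) (auto simp: summable_def)
  have N_lim: "(\<lambda>n. N n k / real n) \<longlonglongrightarrow> r / real p ^ k" for k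
  proof -
    have "(\<lambda>n. real (n div p ^ k) / real n - 2 * (real (n div p ^ Suc k) / real n)
        + real (n div p ^ Suc (Suc k)) / real n)
      \<longlonglongrightarrow> 1 / real (p ^ k) - 2 * (1 / real (p ^ Suc k)) + 1 / real (p ^ Suc (Suc k))"
      using p by (intro tendsto_intros tendsto_div_over_nat) (simp_all add: Suc_le_eq)
    \<comment> \<open>The factor of the theorem arises here, as \<open>1 - 2 / p + 1 / p ^ 2\<close>
      is the square of \<open>(p - 1) / p\<close>.\<close>
    moreover have "1 / real (p ^ k) - 2 * (1 / real (p ^ Suc k)) + 1 / real (p ^ Suc (Suc k))
        = r / real p ^ k"
      using p by (simp add: r_def field_simps power2_eq_square)
    ultimately show ?thesis
      unfolding N_def card_chain_length_eq[OF p] by (simp add: add_divide_distrib diff_divide_distrib)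
  qed
  have "(\<lambda>n. N n k / real n * (c (Suc k) n / real n)) \<longlonglongrightarrow> g k" for k
    unfolding g_def by (intro tendsto_mult N_lim lam(1))
  note tannery = tendsto_suminf_dominated[OF bound M this]
  have g_sum: "(\<Sum>k. g k) = r * (\<Sum>k. lam (Suc k) / real p ^ k)"
    and lam_summable: "summable (\<lambda>k. lam (Suc k) / real p ^ k)"
  proof -
    \<comment> \<open>Summability passes from \<open>g\<close> to the series without the factor
      because \<open>r\<close> is nonzero.\<close>
    have "g = (\<lambda>k. r * (lam (Suc k) / real p ^ k))" by (auto simp: g_def)
    then have "summable (\<lambda>k. r * (lam (Suc k) / real p ^ k))"
      using tannery(1) by simp
    then show summable: "summable (\<lambda>k. lam (Suc k) / real p ^ k)"
      unfolding summable_cmult_iff using r by blast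
    show "(\<Sum>k. g k) = r * (\<Sum>k. lam (Suc k) / real p ^ k)"
      unfolding \<open>g = _\<close> by (rule suminf_mult[OF summable])
  qed
  have "\<forall>\<^sub>F n in sequentially.
      ereal (\<Sum>k. N n k / real n * (c (Suc k) n / real n)) = entropy_seq Y n"
    using eventually_ge_at_top[of 1]
  proof eventually_elim
    case (elim n)
    have Y: "Y \<noteq> {}" using ne unfolding Y_def mult_axial_product_eq_empty_iff[OF p] .
    have fin: "summable (\<lambda>k. N n k / real n * (c (Suc k) n / real n))"
      by (rule summable_comparison_test'[OF M, of 0]) (rule bound)
    \<comment> \<open>Of the two factors \<open>n\<close> in the area, one normalizes the number of
      chains and the other the height of the strips.\<close>
    have "ln (real (card (patterns ({1..n} \<times> {1..n}) Y)))
        = (\<Sum>k. (real n)\<^sup>2 * (N n k / real n * (c (Suc k) n / real n)))"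
      unfolding Y_def ln_card_patterns_mult_axial_product[OF A p ne]
      using elim by (simp add: N_def c_def Z_def power2_eq_square)
    also have "\<dots> = (real n)\<^sup>2 * (\<Sum>k. N n k / real n * (c (Suc k) n / real n))"
      by (rule suminf_mult[OF fin])
    finally show ?case
      using elim Y by (simp add: entropy_seq_def log_card_def patterns_def)
  qed
  then have ent: "entropy_seq Y \<longlonglongrightarrow> ereal (\<Sum>k. g k)"
    using tannery(2) by (subst tendsto_cong[symmetric]) auto
  have "(\<lambda>k. ereal (lam (Suc k) / real p ^ k)) sums ereal (\<Sum>k. lam (Suc k) / real p ^ k)"
    unfolding sums_ereal by (rule summable_sums[OF lam_summable])
  then have sums: "(\<lambda>k. strip_entropy Z (Suc k) / ereal (real p ^ k))
      sums ereal (\<Sum>k. lam (Suc k) / real p ^ k)"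
    using p by (simp add: strip)
  show ?thesis
    unfolding Z_def[symmetric] Y_def[symmetric] entropy_def limI[OF ent]
      sums_unique[OF sums, symmetric] g_sum r_def[symmetric]
    using convergentI[OF lam(2)] sums_summable[OF sums] convergentI[OF ent] by simp
qed

end
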